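(* Let $(\mathfrak{g},J,g)$ be a Hermitian Lie algebra of real dimension $2n$ and let $D$ be a flat Hermitian connection on $\mathfrak{g}$. Let $T_D\,\mathfrak{g}$ be the associated tangent Lie algebra with its induced Hermitian structure $(\tilde J,\tilde g)$. Then $g$ is a $J$-Hermitian static metric on $\mathfrak{g}$ with constant $\lambda=0$ if and only if $\tilde g$ is a $\tilde J$-Hermitian static metric on $T_D\,\mathfrak{g}$ with constant $\lambda=0$.
   Context: A Hermitian Lie algebra $(\mathfrak{g},J,g)$ is a real Lie algebra with an integrable complex structure $J$ (an endomorphism with $J^2=-\mathrm{Id}$ and vanishing Nijenhuis tensor) and an inner product $g$ with $g(J\cdot,J\cdot)=g(\cdot,\cdot)$; it corresponds to a left-invariant Hermitian structure on the simply connected Lie group with Lie algebra $\mathfrak{g}$, and all differential-geometric notions below are understood for this left-invariant structure. A connection on $\mathfrak{g}$ is a bilinear map $D:\mathfrak{g}\times\mathfrak{g}\to\mathfrak{g}$, $(X,Y)\mapsto D_XY$; it is flat if $D_{[X,Y]}=D_XD_Y-D_YD_X$ for all $X,Y\in\mathfrak{g}$, and Hermitian if $Dg=0$ and $DJ=0$, i.e. each $D_X$ is $g$-skew-symmetric and commutes with $J$. Given a flat connection $D$ on $\mathfrak{g}$, the tangent Lie algebra $T_D\,\mathfrak{g}=\mathfrak{g}\ltimes_D\mathbb{R}^{2n}$ is the vector space $\mathfrak{g}\oplus\mathfrak{g}$ (the second summand identified with $\mathbb{R}^{2n}$) with bracket \[ [(X_1,X_2),(Y_1,Y_2)]_D=([X_1,Y_1],\,D_{X_1}Y_2-D_{Y_1}X_2).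 \] If $D$ is moreover Hermitian, $T_D\,\mathfrak{g}$ carries the complex structure $\tilde J(X_1,X_2)=(JX_1,JX_2)$ and the $\tilde J$-Hermitian inner product $\tilde g((X_1,X_2),(Y_1,Y_2))=g(X_1,Y_1)+g(X_2,Y_2)$, for which $(\mathfrak{g},0)$ and $(0,\mathfrak{g})$ are orthogonal. For a Hermitian metric $g$ on a complex manifold $(M,J)$, with fundamental form $\omega(\cdot,\cdot)=g(\cdot,J\cdot)$, the Bismut connection $\nabla^B$ is the unique connection with $\nabla^B J=\nabla^B g=0$ such that, with $T^B$ its torsion, $c(X,Y,Z)=g(X,T^B(Y,Z))$ is totally skew-symmetric. The metric $g$ is SKT if $dc=0$, equivalently $\partial\overline{\partial}\omega=0$. With the curvature convention $R^B(X,Y)Z=\nabla^B_{[X,Y]}Z-[\nabla^B_X,\nabla^B_Y]Z$, the Bismut Ricci form is $\rho^B(X,Y)=\frac12\sum_{k}g(R^B(X,Y)\mathbf{e}_k,J\mathbf{e}_k)$, where $\{\mathbf{e}_k\}$ is a local $g$-orthonormal frame of $TM$; $(\rho^B)^{(1,1)}$ denotes its $(1,1)$-part with respect to $J$. The metric $g$ is called static (with constant $\lambda$) if it is SKT and $-(\rho^B)^{(1,1)}=\lambda\,\omega$ for some real constant $\lambda$. *)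

theory Defs
  imports "HOL-Analysis.Analysis"
begin

definition lie_algebra :: "('a::real_vector \<Rightarrow> 'a \<Rightarrow> 'a) \<Rightarrow> bool" where
  "lie_algebra br \<longleftrightarrow> bilinear br \<and> (\<forall>x. br x x = 0) \<and>
     (\<forall>x y z. br x (br y z) + br y (br z x) + br z (br x y) = 0)"

definition finite_dimensional_space :: "'a::real_vector itself \<Rightarrow> bool" where
  "finite_dimensional_space _ \<longleftrightarrow> (\<exists>B :: 'a set. finite B \<and> span B = UNIV)"

definition inner_product :: "('a::real_vector \<Rightarrow> 'a \<Rightarrow> real) \<Rightarrow> bool" where
  "inner_product g \<longleftrightarrow> bilinear g \<and> (\<forall>x y. g x y = g y x) \<and> (\<forall>x. x \<noteq> 0 \<longrightarrow> g x x > 0)"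

definition nijenhuis :: "('a::real_vector \<Rightarrow> 'a \<Rightarrow> 'a) \<Rightarrow> ('a \<Rightarrow> 'a) \<Rightarrow> 'a \<Rightarrow> 'a \<Rightarrow> 'a" where
  "nijenhuis br J x y = br (J x) (J y) - J (br (J x) y) - J (br x (J y)) - br x y"

definition complex_structure :: "('a::real_vector \<Rightarrow> 'a \<Rightarrow> 'a) \<Rightarrow> ('a \<Rightarrow> 'a) \<Rightarrow> bool" where
  "complex_structure br J \<longleftrightarrow>
     linear J \<and> (\<forall>x. J (J x) = - x) \<and> (\<forall>x y. nijenhuis br J x y = 0)"

definition hermitian_lie_algebra ::
  "('a::real_vector \<Rightarrow> 'a \<Rightarrow> 'a) \<Rightarrow> ('a \<Rightarrow> 'a) \<Rightarrow> ('a \<Rightarrow> 'a \<Rightarrow> real) \<Rightarrow> bool" where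
  "hermitian_lie_algebra br J g \<longleftrightarrow>
     finite_dimensional_space TYPE('a) \<and> lie_algebra br \<and> complex_structure br J \<and>
     inner_product g \<and> (\<forall>x y. g (J x) (J y) = g x y)"

definition flat_connection ::
  "('a::real_vector \<Rightarrow> 'a \<Rightarrow> 'a) \<Rightarrow> ('a \<Rightarrow> 'a \<Rightarrow> 'a) \<Rightarrow> bool" where
  "flat_connection br D \<longleftrightarrow>
     bilinear D \<and> (\<forall>x y z. D (br x y) z = D x (D y z) - D y (D x z))"

definition hermitian_connection ::
  "('a::real_vector \<Rightarrow> 'a) \<Rightarrow> ('a \<Rightarrow> 'a \<Rightarrow> real) \<Rightarrow> ('a \<Rightarrow> 'a \<Rightarrow> 'a) \<Rightarrow> bool" where
  "hermitian_connection J g D \<longleftrightarrow>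
     bilinear D \<and> (\<forall>x y z. g (D x y) z = - g y (D x z)) \<and> (\<forall>x y. D x (J y) = J (D x y))"

definition tangent_bracket ::
  "('a::real_vector \<Rightarrow> 'a \<Rightarrow> 'a) \<Rightarrow> ('a \<Rightarrow> 'a \<Rightarrow> 'a) \<Rightarrow> 'a \<times> 'a \<Rightarrow> 'a \<times> 'a \<Rightarrow> 'a \<times> 'a" where
  "tangent_bracket br D = (\<lambda>(x1, x2) (y1, y2). (br x1 y1, D x1 y2 - D y1 x2))"

definition tangent_complex_structure :: "('a \<Rightarrow> 'a) \<Rightarrow> 'a \<times> 'a \<Rightarrow> 'a \<times> 'a" where
  "tangent_complex_structure J = (\<lambda>(x1, x2). (J x1, J x2))"

definition tangent_metric :: "('a \<Rightarrow> 'a \<Rightarrow> real) \<Rightarrow> 'a \<times> 'a \<Rightarrow> 'a \<times> 'a \<Rightarrow> real" where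
  "tangent_metric g = (\<lambda>(x1, x2) (y1, y2). g x1 y1 + g x2 y2)"

definition fundamental_form :: "('a \<Rightarrow> 'a) \<Rightarrow> ('a \<Rightarrow> 'a \<Rightarrow> real) \<Rightarrow> 'a \<Rightarrow> 'a \<Rightarrow> real" where
  "fundamental_form J g x y = g x (J y)"

definition torsion ::
  "('a::real_vector \<Rightarrow> 'a \<Rightarrow> 'a) \<Rightarrow> ('a \<Rightarrow> 'a \<Rightarrow> 'a) \<Rightarrow> 'a \<Rightarrow> 'a \<Rightarrow> 'a" where
  "torsion br D x y = D x y - D y x - br x y"

definition totally_skew :: "('a \<Rightarrow> 'a \<Rightarrow> 'a \<Rightarrow> real) \<Rightarrow> bool" where
  "totally_skew c \<longleftrightarrow> (\<forall>x y z. c y x z = - c x y z) \<and> (\<forall>x y z. c x z y = - c x y z)"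

definition is_bismut_connection ::
  "('a::real_vector \<Rightarrow> 'a \<Rightarrow> 'a) \<Rightarrow> ('a \<Rightarrow> 'a) \<Rightarrow> ('a \<Rightarrow> 'a \<Rightarrow> real) \<Rightarrow> ('a \<Rightarrow> 'a \<Rightarrow> 'a) \<Rightarrow> bool" where
  "is_bismut_connection br J g D \<longleftrightarrow>
     hermitian_connection J g D \<and> totally_skew (\<lambda>x y z. g x (torsion br D y z))"

text \<open>The Bismut connection of a left-invariant Hermitian structure is itself left-invariant,
  being unique, so it is determined by a bilinear map on the Lie algebra.\<close>

definition bismut_connection ::
  "('a::real_vector \<Rightarrow> 'a \<Rightarrow> 'a) \<Rightarrow> ('a \<Rightarrow> 'a) \<Rightarrow> ('a \<Rightarrow> 'a \<Rightarrow> real) \<Rightarrow> 'a \<Rightarrow> 'a \<Rightarrow> 'a" where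
  "bismut_connection br J g = (THE D. is_bismut_connection br J g D)"

definition bismut_torsion_form ::
  "('a::real_vector \<Rightarrow> 'a \<Rightarrow> 'a) \<Rightarrow> ('a \<Rightarrow> 'a) \<Rightarrow> ('a \<Rightarrow> 'a \<Rightarrow> real) \<Rightarrow> 'a \<Rightarrow> 'a \<Rightarrow> 'a \<Rightarrow> real" where
  "bismut_torsion_form br J g x y z = g x (torsion br (bismut_connection br J g) y z)"

text \<open>The exterior derivative of a left-invariant 3-form, evaluated on left-invariant fields:
  in the invariant formula for \<open>d\<close> the terms differentiating \<open>c\<close> along a field vanish.\<close>

definition ext_deriv3 ::
  "('a::real_vector \<Rightarrow> 'a \<Rightarrow> 'a) \<Rightarrow> ('a \<Rightarrow> 'a \<Rightarrow> 'a \<Rightarrow> real) \<Rightarrow> 'a \<Rightarrow> 'a \<Rightarrow> 'a \<Rightarrow> 'a \<Rightarrow> real" where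
  "ext_deriv3 br c x y z w =
     - c (br x y) z w + c (br x z) y w - c (br x w) y z
     - c (br y z) x w + c (br y w) x z - c (br z w) x y"

definition skt ::
  "('a::real_vector \<Rightarrow> 'a \<Rightarrow> 'a) \<Rightarrow> ('a \<Rightarrow> 'a) \<Rightarrow> ('a \<Rightarrow> 'a \<Rightarrow> real) \<Rightarrow> bool" where
  "skt br J g \<longleftrightarrow> (\<forall>x y z w. ext_deriv3 br (bismut_torsion_form br J g) x y z w = 0)"

definition curvature ::
  "('a::real_vector \<Rightarrow> 'a \<Rightarrow> 'a) \<Rightarrow> ('a \<Rightarrow> 'a \<Rightarrow> 'a) \<Rightarrow> 'a \<Rightarrow> 'a \<Rightarrow> 'a \<Rightarrow> 'a" where
  "curvature br D x y z = D (br x y) z - (D x (D y z) - D y (D x z))"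

definition orthonormal_basis :: "('a::real_vector \<Rightarrow> 'a \<Rightarrow> real) \<Rightarrow> 'a set \<Rightarrow> bool" where
  "orthonormal_basis g B \<longleftrightarrow>
     finite B \<and> span B = UNIV \<and> (\<forall>x\<in>B. \<forall>y\<in>B. g x y = (if x = y then 1 else 0))"

text \<open>The sum is a trace, so it does not depend on the orthonormal basis chosen.\<close>

definition bismut_ricci_form ::
  "('a::real_vector \<Rightarrow> 'a \<Rightarrow> 'a) \<Rightarrow> ('a \<Rightarrow> 'a) \<Rightarrow> ('a \<Rightarrow> 'a \<Rightarrow> real) \<Rightarrow> 'a \<Rightarrow> 'a \<Rightarrow> real" where
  "bismut_ricci_form br J g x y =
     (1/2) * (\<Sum>e\<in>(SOME B. orthonormal_basis g B).
                g (curvature br (bismut_connection br J g) x y e) (J e))"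

text \<open>On complexified vectors \<open>\<beta>(J\<cdot>, J\<cdot>)\<close> equals \<open>\<beta>\<close> for type (1,1) and \<open>- \<beta>\<close> for types (2,0)
  and (0,2), so the (1,1)-part of a real 2-form is its \<open>J\<close>-invariant part.\<close>

definition part_1_1 ::
  "('a \<Rightarrow> 'a) \<Rightarrow> ('a \<Rightarrow> 'a \<Rightarrow> real) \<Rightarrow> 'a \<Rightarrow> 'a \<Rightarrow> real" where
  "part_1_1 J \<beta> x y = (\<beta> x y + \<beta> (J x) (J y)) / 2"

definition static_metric ::
  "('a::real_vector \<Rightarrow> 'a \<Rightarrow> 'a) \<Rightarrow> ('a \<Rightarrow> 'a) \<Rightarrow> ('a \<Rightarrow> 'a \<Rightarrow> real) \<Rightarrow> real \<Rightarrow> bool" where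
  "static_metric br J g l \<longleftrightarrow>
     hermitian_lie_algebra br J g \<and> skt br J g \<and>
     (\<forall>x y. - part_1_1 J (bismut_ricci_form br J g) x y = l * fundamental_form J g x y)"

end

theory Submission
  imports Defs
begin

text \<open>The connection \<open>(x1, x2), (y1, y2) \<mapsto> (B x1 y1, D x1 y2)\<close>, where \<open>B\<close> is the Bismut
  connection of \<open>g\<close>, is Hermitian and has torsion \<open>(T x1 y1, 0)\<close>, so it is the Bismut connection
  of the tangent Lie algebra. As \<open>D\<close> is flat, its curvature is \<open>(R x1 y1, 0)\<close>. Hence the torsion
  form, its exterior derivative and the Bismut Ricci form of the tangent Lie algebra are all pulled
  back from \<open>g\<close> along the first projection.\<close>

section \<open>Inner products, orthonormal bases and traces\<close>

lemma inner_product_bilinear: "inner_product g \<Longrightarrow> bilinear g"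
  and inner_product_commute: "inner_product g \<Longrightarrow> g x y = g y x"
  and inner_product_pos: "inner_product g \<Longrightarrow> x \<noteq> 0 \<Longrightarrow> g x x > 0"
  by (auto simp: inner_product_def)

text \<open>Nondegeneracy, from positivity on \<open>x - y\<close>. It lets identities between
  vectors be proved by pairing with an arbitrary \<open>z\<close>.\<close>

lemma inner_product_eqI:
  assumes g: "inner_product g" and eq: "\<And>z. g x z = g y z"
  shows "x = y"
proof (rule ccontr)
  assume "x \<noteq> y"
  then have "g (x - y) (x - y) > 0"
    using inner_product_pos[OF g] by simp
  moreover have "g (x - y) (x - y) = 0"
    using eq by (simp add: bilinear_lsub[OF inner_product_bilinear[OF g]])
  ultimately show False by simp
qed

lemma bilinear_sum_left: "bilinear h \<Longrightarrow> h (sum f A) y = (\<Sum>i\<in>A. h (f i) y)"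
  by (rule linear_sum) (simp add: bilinear_def)

lemma bilinear_sum_right: "bilinear h \<Longrightarrow> h x (sum f A) = (\<Sum>i\<in>A. h x (f i))"
  by (rule linear_sum) (simp add: bilinear_def)

lemmas bilinear_simps =
  bilinear_ladd bilinear_radd bilinear_lmul bilinear_rmul bilinear_lneg bilinear_rneg
  bilinear_lsub bilinear_rsub bilinear_lzero bilinear_rzero

lemma inner_orthonormal_sum:
  assumes g: "inner_product g" and B: "finite B" "\<forall>x\<in>B. \<forall>y\<in>B. g x y = (if x = y then 1 else 0)"
    and e: "e \<in> B"
  shows "g (\<Sum>b\<in>B. c b *\<^sub>R b) e = c e"
proof -
  have "g (\<Sum>b\<in>B. c b *\<^sub>R b) e = (\<Sum>b\<in>B. c b * g b e)"
    using inner_product_bilinear[OF g] by (simp add: bilinear_sum_left bilinear_lmul)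
  also have "\<dots> = (\<Sum>b\<in>B. if b = e then c b else 0)"
    using B e by (intro sum.cong) auto
  also have "\<dots> = c e"
    using B e by simp
  finally show ?thesis .
qed

text \<open>Spanning supplies some coefficients, and pairing with each basis vector identifies
  them.\<close>

lemma orthonormal_basis_expansion:
  assumes g: "inner_product g" and B: "orthonormal_basis g B"
  shows "x = (\<Sum>e\<in>B. g x e *\<^sub>R e)"
proof -
  have fin: "finite B" "\<forall>x\<in>B. \<forall>y\<in>B. g x y = (if x = y then 1 else 0)" and "x \<in> span B"
    using B by (auto simp: orthonormal_basis_def)
  then obtain c where c: "x = (\<Sum>e\<in>B. c e *\<^sub>R e)"
    by (auto simp: span_finite)
  have "c e = g x e" if "e \<in> B" for e
    using inner_orthonormal_sum[OF g fin that, of c] c by simp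
  with c show ?thesis by (metis (no_types, lifting) sum.cong)
qed

text \<open>Expand the first slot of \<open>h e e\<close> over \<open>C\<close> and swap the sums.
  By symmetry of \<open>g\<close>, the sum over \<open>B\<close> then reassembles \<open>f\<close>
  in the second slot.\<close>

lemma trace_orthonormal_basis_eq:
  assumes g: "inner_product g" and B: "orthonormal_basis g B" and C: "orthonormal_basis g C"
    and h: "bilinear h"
  shows "(\<Sum>e\<in>B. h e e) = (\<Sum>f\<in>C. h f f :: real)"
proof -
  have "(\<Sum>e\<in>B. h e e) = (\<Sum>e\<in>B. h (\<Sum>f\<in>C. g e f *\<^sub>R f) e)"
    by (simp add: orthonormal_basis_expansion[OF g C, symmetric])
  also have "\<dots> = (\<Sum>e\<in>B. \<Sum>f\<in>C. g e f * h f e)"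
    using h by (simp add: bilinear_sum_left bilinear_lmul)
  also have "\<dots> = (\<Sum>f\<in>C. \<Sum>e\<in>B. g f e * h f e)"
    by (subst sum.swap) (simp add: inner_product_commute[OF g])
  also have "\<dots> = (\<Sum>f\<in>C. h f (\<Sum>e\<in>B. g f e *\<^sub>R e))"
    using h by (simp add: bilinear_sum_right bilinear_rmul)
  also have "\<dots> = (\<Sum>f\<in>C. h f f)"
    by (simp add: orthonormal_basis_expansion[OF g B, symmetric])
  finally show ?thesis .
qed

text \<open>Induction on \<open>S\<close>: the new vector loses its projection \<open>p\<close> onto
  the span so far. Either nothing remains and the vector is redundant, or the remainder is
  normalised and added.\<close>

lemma gram_schmidt:
  assumes g: "inner_product g" and "finite S"
  shows "\<exists>C. finite C \<and> span C = span S \<and> (\<forall>x\<in>C. \<forall>y\<in>C. g x y = (if x = y then 1 else 0))"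
  using \<open>finite S\<close>
proof (induction S)
  case empty
  show ?case by (intro exI[of _ "{}"]) simp
next
  case (insert x S)
  then obtain C where C: "finite C" "span C = span S"
    "\<forall>x\<in>C. \<forall>y\<in>C. g x y = (if x = y then 1 else 0)" by blast
  note bil = inner_product_bilinear[OF g]
  define p where "p = (\<Sum>e\<in>C. g x e *\<^sub>R e)"
  define y where "y = x - p"
  have p: "p \<in> span C"
    unfolding p_def by (intro span_sum span_scale span_base)
  have orth: "g y e = 0" if "e \<in> C" for e
    using inner_orthonormal_sum[OF g C(1,3) that, of "g x"]
    by (simp add: y_def p_def bilinear_lsub[OF bil])
  have span: "span (insert x S) = span (insert x C)"
    using C(2) by (simp add: span_insert)
  show ?case
  proof (cases "y = 0")
    case True
    then have "x \<in> span C" using p by (simp add: y_def)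
    then show ?thesis using C span by (intro exI[of _ C]) (simp add: span_redundant)
  next
    case False
    define r where "r = sqrt (g y y)"
    have r: "r > 0" "r * r = g y y"
      using inner_product_pos[OF g False] by (auto simp: r_def)
    define z where "z = (1/r) *\<^sub>R y"
    have y: "y = r *\<^sub>R z" using r by (simp add: z_def)
    have "g z z = 1" using r(1) by (simp add: z_def r(2)[symmetric] bilinear_lmul[OF bil] bilinear_rmul[OF bil])
    moreover have "g z e = 0" "g e z = 0" if "e \<in> C" for e
      using orth[OF that] inner_product_commute[OF g, of e y]
      by (simp_all add: z_def bilinear_lmul[OF bil] bilinear_rmul[OF bil])
    ultimately have on: "\<forall>x\<in>insert z C. \<forall>y\<in>insert z C. g x y = (if x = y then 1 else 0)"
      using C(3) by auto
    have p': "p \<in> span (insert v C)" for v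
      using p span_mono[of C "insert v C"] by blast
    have "x = y + p" by (simp add: y_def)
    with y have "x \<in> span (insert z C)"
      by (metis p' span_add span_scale span_base insertI1)
    moreover have "z \<in> span (insert x C)"
      unfolding z_def y_def by (intro span_scale span_diff p' span_base insertI1)
    ultimately have "span (insert z C) = span (insert x C)"
      by (intro subset_antisym span_minimal subspace_span) (auto intro: span_base)
    then show ?thesis using C on span by (intro exI[of _ "insert z C"]) simp
  qed
qed

lemma orthonormal_basis_exists:
  fixes g :: "'a::real_vector \<Rightarrow> 'a \<Rightarrow> real"
  assumes "finite_dimensional_space TYPE('a)" "inner_product g"
  shows "\<exists>B. orthonormal_basis g B"
proof -
  obtain S :: "'a set" where "finite S" "span S = UNIV"
    using assms(1) by (auto simp: finite_dimensional_space_def)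
  with gram_schmidt[OF assms(2), of S] show ?thesis
    by (simp add: orthonormal_basis_def)
qed

section \<open>Hermitian Lie algebras and their Bismut connection\<close>

lemma hermitian_connectionD:
  assumes "hermitian_connection J g D"
  shows "bilinear D" "g (D x y) z = - g y (D x z)" "D x (J y) = J (D x y)"
  using assms by (simp_all add: hermitian_connection_def)

lemma hermitian_lie_algebraD:
  fixes g :: "'a::real_vector \<Rightarrow> 'a \<Rightarrow> real"
  assumes "hermitian_lie_algebra br J g"
  shows "finite_dimensional_space TYPE('a)" "inner_product g" "bilinear br" "linear J"
    "J (J x) = - x" "g (J x) (J y) = g x y" "br x x = 0"
    "br (J x) (J y) = J (br (J x) y) + J (br x (J y)) + br x y"
    "br x (br y z) + br y (br z x) + br z (br x y) = 0"
  using assms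
  by (auto simp: hermitian_lie_algebra_def lie_algebra_def complex_structure_def nijenhuis_def
      algebra_simps)

lemma lie_bracket_skew:
  assumes "hermitian_lie_algebra br J g"
  shows "br y x = - br x y"
proof -
  note bil = hermitian_lie_algebraD(3)[OF assms]
  have "br (x + y) (x + y) = br x x + br y x + (br x y + br y y)"
    by (simp only: bilinear_ladd[OF bil] bilinear_radd[OF bil])
  then show ?thesis
    by (simp add: hermitian_lie_algebraD(7)[OF assms] eq_neg_iff_add_eq_0 add.commute)
qed

text \<open>The difference of two Bismut connections is a 3-form \<open>a\<close> with
  \<open>a(x, J y, J z) = a(x, y, z)\<close>; moving two \<open>J\<close>s around cyclically forces \<open>a = - a\<close>.\<close>

lemma is_bismut_connection_unique:
  assumes g: "inner_product g" and J: "\<And>x y. g (J x) (J y) = g x y" "\<And>x. J (J x) = - x"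
    and B1: "is_bismut_connection br J g D1" and B2: "is_bismut_connection br J g D2"
  shows "D1 = D2"
proof -
  note bil = inner_product_bilinear[OF g]
  note gs = bilinear_simps[OF bil]
  define a where "a x y z = g (D1 x y) z - g (D2 x y) z" for x y z
  have h1: "hermitian_connection J g D1" and h2: "hermitian_connection J g D2"
    using B1 B2 by (auto simp: is_bismut_connection_def)
  have skew: "a x z y = - a x y z" for x y z
    using hermitian_connectionD(2)[OF h1, of x y z] hermitian_connectionD(2)[OF h2, of x y z]
    by (simp add: a_def inner_product_commute[OF g])
  have aJ: "a x (J y) (J z) = a x y z" for x y z
    by (simp add: a_def hermitian_connectionD(3)[OF h1] hermitian_connectionD(3)[OF h2] J)
  have an: "a x (- y) z = - a x y z" for x y z
    using bilinear_rneg[OF hermitian_connectionD(1)[OF h1]]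
      bilinear_rneg[OF hermitian_connectionD(1)[OF h2]]
    by (simp add: a_def gs)
  \<comment> \<open>The bracket cancels in the difference of the two torsions, leaving only terms in
    \<open>a\<close>.\<close>
  define t where "t x y z = a y z x - a z y x" for x y z
  have t: "t x y z = g x (torsion br D1 y z) - g x (torsion br D2 y z)" for x y z
    by (simp add: t_def a_def torsion_def gs inner_product_commute[OF g, of x])
  have tskew: "t y x z = - t x y z" for x y z
  proof -
    have "g y (torsion br D1 x z) = - g x (torsion br D1 y z)"
      "g y (torsion br D2 x z) = - g x (torsion br D2 y z)"
      using B1 B2 unfolding is_bismut_connection_def totally_skew_def by blast+
    then show ?thesis by (simp add: t)
  qed
  \<comment> \<open>Given skewness of \<open>a\<close> in its last two slots, skewness of
    \<open>t\<close> amounts to cyclic invariance of \<open>a\<close>.\<close>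
  have tot: "a y x z = - a x y z" for x y z
    using tskew[of x y z] tskew[of y z x] tskew[of z x y]
      skew[of x y z] skew[of y z x] skew[of z x y]
    unfolding t_def by argo
  have "a x y z = 0" for x y z
  proof -
    have 1: "a (J u) (J v) w = a u v w" for u v w
      by (metis aJ skew tot)
    have 2: "a (J u) v (J w) = a u v w" for u v w
      by (metis 1 skew)
    \<comment> \<open>Two pair invariances insert four \<open>J\<close>s, two of them on
      \<open>y\<close>. Replacing \<open>J (J y)\<close> by \<open>- y\<close> costs a sign, and the
      third invariance removes the remaining pair.\<close>
    have "a x y z = a (J x) (J (J y)) (J z)" using 1 aJ by metis
    also have "\<dots> = - a x y z" by (simp add: J an 2)
    finally show ?thesis by simp
  qed
  then have "D1 x y = D2 x y" for x y
    by (intro inner_product_eqI[OF g]) (simp add: a_def)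
  then show ?thesis by blast
qed

text \<open>The witness is given by \<open>2 g(D x y, z) = K(x, y, z) + c(x, y, z)\<close>, where \<open>K\<close> is the
  right-hand side of Koszul's formula for the Levi-Civita connection and
  \<open>c(x, y, z) = - d\<omega>(J x, J y, J z)\<close>.\<close>

lemma is_bismut_connection_exists:
  assumes H: "hermitian_lie_algebra br J g"
  shows "\<exists>D. is_bismut_connection br J g D"
proof -
  note g = hermitian_lie_algebraD(2)[OF H]
  note J2 = hermitian_lie_algebraD(5)[OF H]
  note gJ = hermitian_lie_algebraD(6)[OF H]
  note nij = hermitian_lie_algebraD(8)[OF H]
  note sk = lie_bracket_skew[OF H]
  note gs = bilinear_simps[OF inner_product_bilinear[OF g]]
  note bs = bilinear_simps[OF hermitian_lie_algebraD(3)[OF H]]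
  note Jlin = hermitian_lie_algebraD(4)[OF H]
  note Js = linear_add[OF Jlin] linear_cmul[OF Jlin] linear_neg[OF Jlin]
  have gJ': "g (J x) y = - g x (J y)" for x y
    using gJ[of "J x" y] by (simp add: J2 gs)
  \<comment> \<open>The first three terms are \<open>K\<close>, where left-invariance leaves only
    brackets. The last three are \<open>c\<close>, since \<omega>(u, J v) = - g(u, v).\<close>
  define h where "h x y z = (g (br x y) z - g (br y z) x + g (br z x) y
    - g (br (J x) (J y)) z - g (br (J y) (J z)) x - g (br (J z) (J x)) y) / 2" for x y z
  obtain E where E: "orthonormal_basis g E"
    using orthonormal_basis_exists[OF hermitian_lie_algebraD(1)[OF H] g] by blast
  \<comment> \<open>Riesz representation: \<open>D x y\<close> is the vector dual to the linear form
    \<open>h x y\<close>.\<close>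
  define D where "D x y = (\<Sum>e\<in>E. h x y e *\<^sub>R e)" for x y
  have gD: "g (D x y) z = h x y z" for x y z
  proof -
    have lin: "linear (h x y)"
      by (rule linearI) (simp_all add: h_def gs bs Js algebra_simps add_divide_distrib diff_divide_distrib)
    have "g (D x y) z = (\<Sum>e\<in>E. g z e * h x y e)"
      unfolding D_def
      by (simp add: bilinear_sum_left[OF inner_product_bilinear[OF g]] gs
          inner_product_commute[OF g, of z] mult.commute)
    also have "\<dots> = h x y (\<Sum>e\<in>E. g z e *\<^sub>R e)"
      by (simp add: linear_sum[OF lin] linear_cmul[OF lin])
    also have "\<dots> = h x y z"
      by (simp add: orthonormal_basis_expansion[OF g E, symmetric])
    finally show ?thesis .
  qed
  have "bilinear D"
    unfolding bilinear_def
    by (intro conjI allI linearI inner_product_eqI[OF g];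
        simp add: gD gs, simp add: h_def gs bs Js algebra_simps add_divide_distrib diff_divide_distrib)
  moreover have "g (D x y) z = - g y (D x z)" for x y z
  proof -
    have "h x y z = - h x z y"
      unfolding h_def minus_divide_left
      by (rule arg_cong[where f = "\<lambda>t. t / 2"])
        (simp add: sk[of y x] sk[of z x] sk[of z y] sk[of "J y" "J x"] sk[of "J z" "J x"]
          sk[of "J z" "J y"] gs)
    then show ?thesis by (simp add: gD inner_product_commute[OF g, of y])
  qed
  moreover have "D x (J y) = J (D x y)" for x y
  proof (rule inner_product_eqI[OF g])
    fix z
    \<comment> \<open>Integrability of \<open>J\<close> enters here. In the identity for
      \<open>h\<close> below, the terms paired with \<open>x\<close> match directly; integrability
      for the pairs (x, y) and (z, x) settles the others.\<close>
    have 1: "g (br (J x) (J y)) z = g (br x y) z - g (br (J x) y) (J z) - g (br x (J y)) (J z)" for x y z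
      by (simp add: nij gs gJ')
    have "h x (J y) z = - h x y (J z)"
      unfolding h_def J2 bs gs minus_divide_left
      by (rule arg_cong[where f = "\<lambda>t. t / 2"])
        (use 1[of x y "J z"] 1[of z x "J y"] in \<open>simp add: J2 gs\<close>)
    then show "g (D x (J y)) z = g (J (D x y)) z"
      by (simp add: gJ' gD)
  qed
  moreover have "totally_skew (\<lambda>x y z. g x (torsion br D y z))"
  proof -
    \<comment> \<open>The Koszul part is torsion-free, so only \<open>c\<close> remains; it is
      invariant under cyclic permutation.\<close>
    have T: "g x (torsion br D y z)
        = - g (br (J x) (J y)) z - g (br (J y) (J z)) x - g (br (J z) (J x)) y" for x y z
      unfolding inner_product_commute[OF g, of x]
      by (simp add: torsion_def gs gD h_def sk[of y x] sk[of z x] sk[of z y] sk[of "J y" "J x"]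
          sk[of "J z" "J x"] sk[of "J z" "J y"] field_simps)
    show ?thesis
      unfolding totally_skew_def T
    proof (intro conjI allI, goal_cases)
      case (1 x y z)
      then show ?case
        by (simp add: gs sk[of "J y" "J x"] sk[of "J z" "J x"] sk[of "J z" "J y"])
    next
      case (2 x y z)
      then show ?case
        by (simp add: gs sk[of "J y" "J x"] sk[of "J z" "J x"] sk[of "J z" "J y"])
    qed
  qed
  ultimately show ?thesis
    by (auto simp: is_bismut_connection_def hermitian_connection_def)
qed

text \<open>Uniqueness resolves the definite description, so a Bismut connection can be identified
  by exhibiting a candidate and checking its defining properties.\<close>

lemma bismut_connection_eq:
  assumes H: "hermitian_lie_algebra br J g" and D: "is_bismut_connection br J g D"
  shows "bismut_connection br J g = D"
  unfolding bismut_connection_def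
  by (rule the_equality[where P = "is_bismut_connection br J g", OF D])
    (rule is_bismut_connection_unique[OF hermitian_lie_algebraD(2,6,5)[OF H] _ D])

lemma bismut_connection_is_bismut:
  assumes "hermitian_lie_algebra br J g"
  shows "is_bismut_connection br J g (bismut_connection br J g)"
  using bismut_connection_eq[OF assms] is_bismut_connection_exists[OF assms] by metis

text \<open>The summand is the diagonal of a bilinear form, so the sum is a trace and the
  arbitrarily chosen basis may be replaced by any convenient one, such as one adapted to a
  splitting.\<close>

lemma bismut_ricci_form_eq:
  assumes H: "hermitian_lie_algebra br J g" and B: "orthonormal_basis g B"
  shows "bismut_ricci_form br J g x y =
    (1/2) * (\<Sum>e\<in>B. g (curvature br (bismut_connection br J g) x y e) (J e))"
proof -
  note g = hermitian_lie_algebraD(2)[OF H]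
  note bil = inner_product_bilinear[OF g]
  let ?D = "bismut_connection br J g"
  have "bilinear ?D"
    using bismut_connection_is_bismut[OF H]
    by (simp add: is_bismut_connection_def hermitian_connection_def)
  note Ds = bilinear_simps[OF this]
  note Jlin = hermitian_lie_algebraD(4)[OF H]
  have "bilinear (\<lambda>u v. g (curvature br ?D x y u) (J v))"
    unfolding bilinear_def
    by (intro conjI allI linearI)
      (simp_all add: curvature_def Ds bilinear_simps[OF bil] linear_add[OF Jlin]
        linear_cmul[OF Jlin] algebra_simps)
  from trace_orthonormal_basis_eq[OF g someI[of "orthonormal_basis g", OF B] B this]
  show ?thesis by (simp add: bismut_ricci_form_def)
qed

section \<open>The tangent Lie algebra as a Hermitian Lie algebra\<close>

lemma span_product_union_eq_UNIV:
  assumes "span B = UNIV" "span C = UNIV"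
  shows "span ((\<lambda>e. (e, 0)) ` B \<union> (\<lambda>e. (0, e)) ` C) = UNIV"
proof -
  have l: "linear (\<lambda>e::'a. (e, 0::'b))" "linear (\<lambda>e::'b. (0::'a, e))"
    by (auto intro!: linearI)
  have "(x, y) \<in> span ((\<lambda>e. (e, 0)) ` B \<union> (\<lambda>e. (0, e)) ` C)" for x y
    unfolding span_Un linear_span_image[OF l(1)] linear_span_image[OF l(2)] assms
    by (intro CollectI exI[of _ "(x, 0)"] exI[of _ "(0, y)"]) simp
  then show ?thesis by auto
qed

text \<open>Zero does not have length one. Consequently the two copies of \<open>B\<close> in the
  product, which could meet only in (0, 0), are disjoint.\<close>

lemma zero_notin_orthonormal_basis:
  assumes "inner_product g" "orthonormal_basis g B"
  shows "0 \<notin> B"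
  using assms(2) bilinear_lzero[OF inner_product_bilinear[OF assms(1)], of 0]
  by (auto simp: orthonormal_basis_def)

lemma tangent_simps:
  "tangent_bracket br D (x1, x2) (y1, y2) = (br x1 y1, D x1 y2 - D y1 x2)"
  "tangent_complex_structure J (x1, x2) = (J x1, J x2)"
  "tangent_metric g (x1, x2) (y1, y2) = g x1 y1 + g x2 y2"
  by (simp_all add: tangent_bracket_def tangent_complex_structure_def tangent_metric_def)

lemma orthonormal_basis_tangent:
  assumes g: "inner_product g" and B: "orthonormal_basis g B"
  shows "orthonormal_basis (tangent_metric g) ((\<lambda>e. (e, 0)) ` B \<union> (\<lambda>e. (0, e)) ` B)"
  using B span_product_union_eq_UNIV[of B B] zero_notin_orthonormal_basis[OF g B]
  by (auto simp: orthonormal_basis_def tangent_simps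
      bilinear_simps(9,10)[OF inner_product_bilinear[OF g]] split: if_splits) blast+

text \<open>In the second component, the Jacobi identity follows from flatness of \<open>D\<close>,
  and the Nijenhuis tensor vanishes because each \<open>D x\<close> commutes with
  \<open>J\<close>.\<close>

lemma hermitian_lie_algebra_tangent:
  fixes g :: "'a::real_vector \<Rightarrow> 'a \<Rightarrow> real"
  assumes H: "hermitian_lie_algebra br J g" and F: "flat_connection br D"
    and D: "hermitian_connection J g D"
  shows "hermitian_lie_algebra (tangent_bracket br D) (tangent_complex_structure J) (tangent_metric g)"
proof -
  note g = hermitian_lie_algebraD(2)[OF H]
  note gs = bilinear_simps[OF inner_product_bilinear[OF g]]
  note bs = bilinear_simps[OF hermitian_lie_algebraD(3)[OF H]]
  note Ds = bilinear_simps[OF hermitian_connectionD(1)[OF D]]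
  note Jlin = hermitian_lie_algebraD(4)[OF H]
  note Js = linear_add[OF Jlin] linear_cmul[OF Jlin] linear_neg[OF Jlin] linear_diff[OF Jlin]
  have flat: "D (br x y) z = D x (D y z) - D y (D x z)" for x y z
    using F by (simp add: flat_connection_def)
  obtain B where "orthonormal_basis g B"
    using orthonormal_basis_exists[OF hermitian_lie_algebraD(1)[OF H] g] by blast
  from orthonormal_basis_tangent[OF g this] have "finite_dimensional_space TYPE('a \<times> 'a)"
    by (auto simp: finite_dimensional_space_def orthonormal_basis_def)
  moreover have "lie_algebra (tangent_bracket br D)"
    unfolding lie_algebra_def bilinear_def
    by (intro conjI allI linearI)
      (auto simp: tangent_simps bs Ds flat hermitian_lie_algebraD(7)[OF H] algebra_simps
        hermitian_lie_algebraD(9)[OF H, unfolded add.assoc] zero_prod_def)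
  moreover have "complex_structure (tangent_bracket br D) (tangent_complex_structure J)"
    unfolding complex_structure_def
    by (intro conjI allI linearI)
      (auto simp: tangent_simps nijenhuis_def Js Ds
        hermitian_lie_algebraD(5,8)[OF H] hermitian_connectionD(3)[OF D] zero_prod_def)
  moreover have "inner_product (tangent_metric g)"
  proof -
    \<comment> \<open>A nonzero pair may have one zero component, so positivity needs the weak
      inequality for the other summand.\<close>
    have "g x x \<ge> 0" for x
      using inner_product_pos[OF g, of x] by (cases "x = 0") (auto simp: gs)
    then have "g x x + g y y > 0" if "(x, y) \<noteq> 0" for x y
      using that inner_product_pos[OF g]
      by (metis add_pos_nonneg add_nonneg_pos zero_prod_def)
    then show ?thesis
      unfolding inner_product_def bilinear_def
      by (intro conjI allI linearI)
        (auto simp: tangent_simps gs inner_product_commute[OF g] algebra_simps)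
  qed
  ultimately show ?thesis
    unfolding hermitian_lie_algebra_def
    by (auto simp: tangent_simps hermitian_lie_algebraD(6)[OF H])
qed

section \<open>Bismut connection, torsion form and Ricci form of the tangent Lie algebra\<close>

lemma bismut_connection_tangent:
  assumes H: "hermitian_lie_algebra br J g" and F: "flat_connection br D"
    and D: "hermitian_connection J g D"
  shows "bismut_connection (tangent_bracket br D) (tangent_complex_structure J) (tangent_metric g)
    = (\<lambda>(x1, x2) (y1, y2). (bismut_connection br J g x1 y1, D x1 y2))" (is "_ = ?B")
proof (rule bismut_connection_eq[OF hermitian_lie_algebra_tangent[OF assms]])
  let ?D = "bismut_connection br J g"
  have B: "hermitian_connection J g ?D" and T: "totally_skew (\<lambda>x y z. g x (torsion br ?D y z))"
    using bismut_connection_is_bismut[OF H] by (auto simp: is_bismut_connection_def)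
  note Bs = bilinear_simps[OF hermitian_connectionD(1)[OF B]]
  note Ds = bilinear_simps[OF hermitian_connectionD(1)[OF D]]
  have "bilinear ?B"
    unfolding bilinear_def by (intro conjI allI linearI) (auto simp: Bs Ds)
  \<comment> \<open>The second component of the torsion vanishes: the antisymmetrisation of the
    connection there is exactly the second component of the bracket.\<close>
  have eq: "tangent_metric g x (torsion (tangent_bracket br D) ?B y z)
      = g (fst x) (torsion br ?D (fst y) (fst z))" for x y z
    using bilinear_rzero[OF inner_product_bilinear[OF hermitian_lie_algebraD(2)[OF H]]]
    by (cases x; cases y; cases z)
      (simp add: torsion_def tangent_simps)
  have "hermitian_connection (tangent_complex_structure J) (tangent_metric g) ?B"
    using \<open>bilinear ?B\<close> hermitian_connectionD(2,3)[OF B] hermitian_connectionD(2,3)[OF D]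
    by (auto simp: hermitian_connection_def tangent_simps)
  moreover have "totally_skew (\<lambda>x y z. tangent_metric g x (torsion (tangent_bracket br D) ?B y z))"
    unfolding totally_skew_def eq
    using T[unfolded totally_skew_def, THEN conjunct1, rule_format]
      T[unfolded totally_skew_def, THEN conjunct2, rule_format]
    by (intro conjI allI) assumption+
  ultimately show "is_bismut_connection (tangent_bracket br D) (tangent_complex_structure J)
      (tangent_metric g) ?B"
    by (simp add: is_bismut_connection_def)
qed

lemma bismut_torsion_form_tangent:
  assumes H: "hermitian_lie_algebra br J g" and F: "flat_connection br D"
    and D: "hermitian_connection J g D"
  shows "bismut_torsion_form (tangent_bracket br D) (tangent_complex_structure J) (tangent_metric g) x y z
    = bismut_torsion_form br J g (fst x) (fst y) (fst z)"
  using bilinear_rzero[OF inner_product_bilinear[OF hermitian_lie_algebraD(2)[OF H]]]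
  by (cases x; cases y; cases z)
    (simp add: bismut_torsion_form_def bismut_connection_tangent[OF assms] torsion_def tangent_simps)

text \<open>The first projection is a Lie algebra homomorphism, so the exterior derivative commutes
  with pullback along it. Surjectivity of the projection gives both directions.\<close>

lemma skt_tangent_iff:
  assumes H: "hermitian_lie_algebra br J g" and F: "flat_connection br D"
    and D: "hermitian_connection J g D"
  shows "skt (tangent_bracket br D) (tangent_complex_structure J) (tangent_metric g) \<longleftrightarrow> skt br J g"
proof -
  have "ext_deriv3 (tangent_bracket br D)
      (bismut_torsion_form (tangent_bracket br D) (tangent_complex_structure J) (tangent_metric g)) x y z w
    = ext_deriv3 br (bismut_torsion_form br J g) (fst x) (fst y) (fst z) (fst w)" for x y z w
    by (cases x; cases y; cases z; cases w)
      (simp add: ext_deriv3_def bismut_torsion_form_tangent[OF assms] tangent_simps)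
  then show ?thesis by (auto simp: skt_def)
qed

lemma bismut_ricci_form_tangent:
  assumes H: "hermitian_lie_algebra br J g" and F: "flat_connection br D"
    and D: "hermitian_connection J g D"
  shows "bismut_ricci_form (tangent_bracket br D) (tangent_complex_structure J) (tangent_metric g) x y
    = bismut_ricci_form br J g (fst x) (fst y)"
proof -
  note g = hermitian_lie_algebraD(2)[OF H]
  note gs = bilinear_simps[OF inner_product_bilinear[OF g]]
  let ?R = "curvature br (bismut_connection br J g) (fst x) (fst y)"
  let ?f = "\<lambda>u. tangent_metric g (curvature (tangent_bracket br D)
    (bismut_connection (tangent_bracket br D) (tangent_complex_structure J) (tangent_metric g)) x y u)
    (tangent_complex_structure J u)"
  obtain B where B: "orthonormal_basis g B"
    using orthonormal_basis_exists[OF hermitian_lie_algebraD(1)[OF H] g] by blast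
  have "finite B" using B by (simp add: orthonormal_basis_def)
  have "0 \<notin> B" by (rule zero_notin_orthonormal_basis[OF g B])
  \<comment> \<open>Flatness of \<open>D\<close> kills the second component of the
    curvature.\<close>
  have f: "?f u = g (?R (fst u)) (J (fst u))" for u
    using F gs(9)
    by (cases x; cases y; cases u)
      (simp add: curvature_def bismut_connection_tangent[OF assms] tangent_simps flat_connection_def)
  have J0: "J 0 = 0" using hermitian_lie_algebraD(4)[OF H] by (rule linear_0)
  \<comment> \<open>Vectors of the second copy have first component zero and contribute nothing to
    the trace.\<close>
  have "(\<Sum>u\<in>(\<lambda>e. (e, 0)) ` B \<union> (\<lambda>e. (0, e)) ` B. ?f u)
      = (\<Sum>u\<in>(\<lambda>e. (e, 0)) ` B. ?f u) + (\<Sum>u\<in>(\<lambda>e. (0, e)) ` B. ?f u)"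
    using \<open>finite B\<close> \<open>0 \<notin> B\<close> by (intro sum.union_disjoint) auto
  also have "\<dots> = (\<Sum>e\<in>B. g (?R e) (J e))"
    by (simp add: f sum.reindex inj_on_def J0 gs)
  finally show ?thesis
    unfolding bismut_ricci_form_eq[OF hermitian_lie_algebra_tangent[OF assms]
        orthonormal_basis_tangent[OF g B]] bismut_ricci_form_eq[OF H B]
    by simp
qed

theorem theorem4p1:
  fixes br :: "'a::real_vector \<Rightarrow> 'a \<Rightarrow> 'a"
    and J :: "'a \<Rightarrow> 'a"
    and g :: "'a \<Rightarrow> 'a \<Rightarrow> real"
    and D :: "'a \<Rightarrow> 'a \<Rightarrow> 'a"
    and n :: nat
  assumes "hermitian_lie_algebra br J g"
    and "dim (UNIV :: 'a set) = 2 * n"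
    and "flat_connection br D"
    and "hermitian_connection J g D"
  shows "static_metric br J g 0 \<longleftrightarrow>
    static_metric (tangent_bracket br D) (tangent_complex_structure J) (tangent_metric g) 0"
proof -
  note tangent = assms(1,3,4)
  have "part_1_1 (tangent_complex_structure J)
      (bismut_ricci_form (tangent_bracket br D) (tangent_complex_structure J) (tangent_metric g)) x y
    = part_1_1 J (bismut_ricci_form br J g) (fst x) (fst y)" for x y
    by (cases x; cases y)
      (simp add: part_1_1_def bismut_ricci_form_tangent[OF tangent] tangent_simps)
  \<comment> \<open>The fundamental form of the tangent metric also involves second components, but
    the constant 0 removes it. The remaining conditions are pullbacks along a surjection, hence
    equivalent.\<close>
  then show ?thesis
    using assms(1) hermitian_lie_algebra_tangent[OF tangent] skt_tangent_iff[OF tangent]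
    by (auto simp: static_metric_def)
qed

end
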